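(* Let $F$ be a non-trivial forest with $m$ edges, $q$ components, $t'$ components isomorphic to $P_3$, and $k$ internal edges, where each component has at least two edges. Then $$\tau(F)\leq\min\left\{-q(3+2\sqrt{2})+(1+\sqrt{2})\left(m+\tfrac{1}{2}\right),\ 2m+5(k-t')+1\right\}.$$
   Context: Graphs are finite and simple, not necessarily connected. For a graph $G$ with $m$ edges and a bijection $f: E(G)\to\{1,2,\dots,m\}$, let $\phi_f(v)$ be the sum of $f(e)$ over all edges $e$ incident to the vertex $v$. The bijection $f$ is an antimagic labeling of $G$ if $\phi_f(u)\neq\phi_f(v)$ for all pairs of distinct vertices $u,v$; $G$ is antimagic if it admits an antimagic labeling. $P_j$ is the path on $j$ vertices. $G\cup H$ denotes disjoint union, and $tG$ the disjoint union of $t$ copies of $G$. An edge is internal if both of its ends are non-leaf vertices. If $G$ is antimagic, $\tau(G)$ is the maximum non-negative integer $t$ such that $G\cup t'P_3$ is antimagic for all integers $0\leq t'\leq t$; if $G$ is not antimagic, $\tau(G)=-\infty$. *)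

theory Defs
  imports Complex_Main "HOL-Library.Extended_Real"
begin

datatype 'a sgraph = SGraph (verts: "'a set") (edges: "'a set set")

definition simple_graph :: "'a sgraph \<Rightarrow> bool" where
  "simple_graph G \<longleftrightarrow>
     finite (verts G) \<and> (\<forall>e\<in>edges G. e \<subseteq> verts G \<and> card e = 2)"

definition graph_degree :: "'a sgraph \<Rightarrow> 'a \<Rightarrow> nat" where
  "graph_degree G v = card {e \<in> edges G. v \<in> e}"

definition graph_leaf :: "'a sgraph \<Rightarrow> 'a \<Rightarrow> bool" where
  "graph_leaf G v \<longleftrightarrow> v \<in> verts G \<and> graph_degree G v = 1"

definition internal_edges :: "'a sgraph \<Rightarrow> 'a set set" where
  "internal_edges G = {e \<in> edges G. \<forall>v\<in>e. \<not> graph_leaf G v}"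

definition graph_cycle :: "'a sgraph \<Rightarrow> 'a list \<Rightarrow> bool" where
  "graph_cycle G vs \<longleftrightarrow>
     3 \<le> length vs \<and> distinct vs \<and>
     (\<forall>i<length vs. {vs ! i, vs ! (Suc i mod length vs)} \<in> edges G)"

definition forest :: "'a sgraph \<Rightarrow> bool" where
  "forest G \<longleftrightarrow> simple_graph G \<and> (\<nexists>vs. graph_cycle G vs)"

definition induced_subgraph :: "'a sgraph \<Rightarrow> 'a set \<Rightarrow> 'a sgraph" where
  "induced_subgraph G S = SGraph (verts G \<inter> S) {e \<in> edges G. e \<subseteq> S}"

definition connected_rel :: "'a sgraph \<Rightarrow> ('a \<times> 'a) set" where
  "connected_rel G = {(u, v). {u, v} \<in> edges G}\<^sup>* \<inter> verts G \<times> verts G"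

definition graph_components :: "'a sgraph \<Rightarrow> 'a sgraph set" where
  "graph_components G = induced_subgraph G ` (verts G // connected_rel G)"

definition graph_iso :: "'a sgraph \<Rightarrow> 'b sgraph \<Rightarrow> bool" where
  "graph_iso G H \<longleftrightarrow>
     (\<exists>h. bij_betw h (verts G) (verts H) \<and> (`) h ` edges G = edges H)"

definition path_graph :: "nat \<Rightarrow> nat sgraph" where
  "path_graph j = SGraph {..<j} {{i, Suc i} | i. Suc i < j}"

definition disjoint_union :: "'a sgraph \<Rightarrow> 'b sgraph \<Rightarrow> ('a + 'b) sgraph" where
  "disjoint_union G H =
     SGraph (verts G <+> verts H) ((`) Inl ` edges G \<union> (`) Inr ` edges H)"

definition graph_copies :: "nat \<Rightarrow> 'a sgraph \<Rightarrow> (nat \<times> 'a) sgraph" where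
  "graph_copies t G =
     SGraph ({..<t} \<times> verts G) (\<Union>i<t. (`) (Pair i) ` edges G)"

definition vertex_sum :: "'a sgraph \<Rightarrow> ('a set \<Rightarrow> nat) \<Rightarrow> 'a \<Rightarrow> nat" where
  "vertex_sum G f v = (\<Sum>e | e \<in> edges G \<and> v \<in> e. f e)"

definition antimagic_labeling :: "'a sgraph \<Rightarrow> ('a set \<Rightarrow> nat) \<Rightarrow> bool" where
  "antimagic_labeling G f \<longleftrightarrow>
     bij_betw f (edges G) {1..card (edges G)} \<and>
     (\<forall>u\<in>verts G. \<forall>v\<in>verts G. u \<noteq> v \<longrightarrow> vertex_sum G f u \<noteq> vertex_sum G f v)"

definition antimagic :: "'a sgraph \<Rightarrow> bool" where
  "antimagic G \<longleftrightarrow> (\<exists>f. antimagic_labeling G f)"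

text \<open>
  The supremum is the maximum whenever the set of admissible numbers is bounded. If it were
  unbounded, the value would be infinity, so an upper bound on \<open>tau G\<close> by a real number includes
  the claim that the maximum exists (or that the graph is not antimagic).
\<close>

definition tau :: "'a sgraph \<Rightarrow> ereal" where
  "tau G =
     (if antimagic G
      then Sup {ereal (real t) | t.
             \<forall>t'\<le>t. antimagic (disjoint_union G (graph_copies t' (path_graph 3)))}
      else -\<infinity>)"

end

theory Submission
  imports Defs "HOL-Library.Transitive_Closure_Table"
begin

text \<open>
  Both bounds hold for each single \<open>t\<close> such that \<open>H\<close>, the union of \<open>F\<close> and \<open>t\<close> copies of \<open>P\<^sub>3\<close>, is
  antimagic; they come from comparing sums of distinct labels with sums of distinct vertex sums.
  Let \<open>M = m + 2 t\<close> be the number of edges of \<open>H\<close>.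

  For the first bound, every edge label is counted at its two ends, so the vertex sums add up to
  \<open>M (M + 1)\<close>. They are distinct and positive, so with \<open>n\<close> vertices their total is at least
  \<open>n (n + 1) / 2\<close> (\<open>antimagic_vertex_bound\<close>). A forest has at least \<open>m + q\<close> vertices
  (\<open>forest_card_edges_plus_components\<close>), hence \<open>n \<ge> m + q + 3 t\<close>. Each added path contributes three
  vertices but only two edges, and as \<open>3 > 2 sqrt 2\<close>, the resulting quadratic inequality bounds \<open>t\<close>;
  solving it gives exactly the stated expression.

  The second bound concerns the centres of the \<open>P\<^sub>3\<close> components of \<open>H\<close>, of which there are at least
  \<open>t + t'\<close>. If the vertex sum of a centre is at most \<open>M\<close>, then it is the label of some edge, and this
  edge has no leaf, because a leaf would have the same vertex sum as the centre; so at most \<open>k\<close>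
  centres are of this kind. The other \<open>u\<close> centres have distinct sums above \<open>M\<close>, but these sums are
  made of only \<open>2 u\<close> distinct labels up to \<open>M\<close>. Comparing the smallest possible sum of the former
  with the largest possible sum of the latter gives \<open>5 u \<le> 2 M + 1\<close>. Therefore
  \<open>5 (t + t') \<le> 2 M + 1 + 5 k\<close> (\<open>antimagic_p3_bound\<close>). Here \<open>2 M\<close> contains \<open>4 t\<close>, and cancelling this
  against \<open>5 t\<close> leaves the stated bound on \<open>t\<close>.
\<close>

section \<open>Sums of distinct natural numbers\<close>

text \<open>
  The extreme case is \<open>b + 1, \<dots>, b + card A\<close>. The factor 2 keeps the arithmetic series free of
  division. The bound serves once with \<open>b = 0\<close> and once with \<open>b\<close> the number of edges.
\<close>

lemma sum_distinct_above:
  fixes A :: "nat set"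
  assumes "finite A" "\<forall>x\<in>A. b < x"
  shows "card A * (2 * b + card A + 1) \<le> 2 * \<Sum>A"
  using assms
proof (induction A rule: finite_linorder_max_induct)
  case empty
  then show ?case by simp
next
  case (insert x A)
  have "A \<subseteq> {b<..<x}" using insert by auto
  then have "card A \<le> card {b<..<x}" by (intro card_mono) auto
  moreover have "b < x" using insert by auto
  ultimately have x: "b + card A + 1 \<le> x" by simp
  have notin: "x \<notin> A" using insert by auto
  have IH: "card A * (2 * b + card A + 1) \<le> 2 * \<Sum>A" using insert by auto
  have "card (insert x A) * (2 * b + card (insert x A) + 1)
      = card A * (2 * b + card A + 1) + 2 * (b + card A + 1)"
    using notin insert by (simp add: algebra_simps)
  also have "\<dots> \<le> 2 * \<Sum>(insert x A)"
    using IH x notin insert by simp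
  finally show ?case .
qed

text \<open>
  The extreme case is \<open>b, b - 1, \<dots>, b - card A + 1\<close>. The square of the cardinality stands on the
  left because subtraction on the natural numbers would truncate.
\<close>

lemma sum_distinct_below:
  fixes A :: "nat set"
  assumes "finite A" "\<forall>x\<in>A. x \<le> b"
  shows "2 * \<Sum>A + card A * card A \<le> card A * (2 * b + 1)"
  using assms
proof (induction A rule: finite_linorder_min_induct)
  case empty
  then show ?case by simp
next
  case (insert x A)
  have "A \<subseteq> {x<..b}" using insert by auto
  then have "card A \<le> card {x<..b}" by (intro card_mono) auto
  moreover have "x \<le> b" using insert by auto
  ultimately have x: "x + card A \<le> b" by simp
  have notin: "x \<notin> A" using insert by auto
  have IH: "2 * \<Sum>A + card A * card A \<le> card A * (2 * b + 1)" using insert by auto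
  have "2 * \<Sum>(insert x A) + card (insert x A) * card (insert x A)
      = (2 * \<Sum>A + card A * card A) + 2 * (x + card A) + 1"
    using notin insert by (simp add: algebra_simps)
  also have "\<dots> \<le> card (insert x A) * (2 * b + 1)"
    using IH x notin insert by simp
  finally show ?case .
qed

section \<open>Antimagic labelings and the vertices of a graph\<close>

lemma finite_edges: "simple_graph G \<Longrightarrow> finite (edges G)"
  unfolding simple_graph_def by (meson Pow_iff finite_Pow_iff finite_subset subsetI)

lemma sum_vertex_sum:
  assumes "simple_graph G"
  shows "(\<Sum>v\<in>verts G. vertex_sum G f v) = 2 * (\<Sum>e\<in>edges G. f e)"
proof -
  have "(\<Sum>v\<in>verts G. vertex_sum G f v)
      = (\<Sum>e\<in>edges G. \<Sum>v | v \<in> verts G \<and> v \<in> e. f e)"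
    unfolding vertex_sum_def
    using assms by (intro sum.swap_restrict) (auto simp: finite_edges simple_graph_def)
  also have "\<dots> = (\<Sum>e\<in>edges G. 2 * f e)"
  proof (rule sum.cong[OF refl])
    fix e assume "e \<in> edges G"
    then have "{v \<in> verts G. v \<in> e} = e" "card e = 2"
      using assms by (auto simp: simple_graph_def)
    then show "(\<Sum>v | v \<in> verts G \<and> v \<in> e. f e) = 2 * f e" by simp
  qed
  finally show ?thesis by (simp add: sum_distrib_left)
qed

lemma vertex_sum_pos:
  assumes "simple_graph G" "antimagic_labeling G f" "graph_degree G v \<noteq> 0"
  shows "0 < vertex_sum G f v"
proof -
  have "{e \<in> edges G. v \<in> e} \<noteq> {}"
    using assms(3) unfolding graph_degree_def by (metis card.empty)
  then obtain e where e: "e \<in> edges G" "v \<in> e" by auto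
  then have "0 < f e"
    using assms(2) unfolding antimagic_labeling_def bij_betw_def by force
  also have "f e \<le> vertex_sum G f v"
    unfolding vertex_sum_def using e finite_edges[OF assms(1)] by (intro member_le_sum) auto
  finally show ?thesis .
qed

lemma inj_on_vertex_sum:
  "antimagic_labeling G f \<Longrightarrow> inj_on (vertex_sum G f) (verts G)"
  unfolding antimagic_labeling_def inj_on_def by blast

text \<open>
  Twice the sum of the labels \<open>1, \<dots>, M\<close> is distributed over the vertices as distinct positive
  numbers, so there cannot be too many vertices. Without isolated vertices all vertex sums are
  positive; a vertex with sum 0 would shift the extreme case by one.
\<close>

lemma antimagic_vertex_bound:
  assumes G: "simple_graph G" and f: "antimagic_labeling G f"
    and deg: "\<forall>v\<in>verts G. graph_degree G v \<noteq> 0"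
  shows "card (verts G) * (card (verts G) + 1) \<le> 2 * (card (edges G) * (card (edges G) + 1))"
proof -
  let ?M = "card (edges G)" and ?A = "vertex_sum G f ` verts G"
  have fin: "finite (verts G)" using G by (simp add: simple_graph_def)
  have cA: "card ?A = card (verts G)"
    using inj_on_vertex_sum[OF f] by (rule card_image)
  have "card ?A * (2 * 0 + card ?A + 1) \<le> 2 * \<Sum>?A"
    using fin vertex_sum_pos[OF G f] deg by (intro sum_distinct_above) auto
  also have "\<Sum>?A = (\<Sum>v\<in>verts G. vertex_sum G f v)"
    using sum.reindex[OF inj_on_vertex_sum[OF f], of "\<lambda>x. x"] by simp
  also have "\<dots> = 2 * (\<Sum>e\<in>edges G. f e)" by (rule sum_vertex_sum[OF G])
  also have "(\<Sum>e\<in>edges G. f e) = \<Sum>{1..?M}"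
    using sum.reindex_bij_betw[of f "edges G" "{1..?M}" "\<lambda>x. x"] f
    by (simp add: antimagic_labeling_def)
  also have "2 * \<Sum>{1..?M} = ?M * (?M + 1)"
    using gauss_sum_from_Suc_0[of ?M, where ?'a = nat] by simp
  finally show ?thesis using cA by simp
qed

section \<open>Centres of three-vertex path components\<close>

text \<open>
  A vertex of degree 2 whose two neighbours are leaves is precisely the middle vertex of a component
  isomorphic to \<open>P\<^sub>3\<close>. This local form refers neither to components nor to isomorphisms. The leaf \<open>w\<close> of
  an edge at \<open>v\<close> is never \<open>v\<close> itself, since \<open>v\<close> has degree 2.
\<close>

definition p3_centers :: "'a sgraph \<Rightarrow> 'a set" where
  "p3_centers G = {v \<in> verts G. graph_degree G v = 2 \<and>
     (\<forall>e\<in>edges G. v \<in> e \<longrightarrow> (\<exists>w\<in>e. graph_leaf G w))}"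

text \<open>
  An edge at two centres would have a leaf as a third end. Hence the vertex sums of different
  centres use disjoint sets of labels.
\<close>

lemma p3_centers_no_common_edge:
  assumes G: "simple_graph G" and "c \<in> p3_centers G" "d \<in> p3_centers G"
    and "e \<in> edges G" "c \<in> e" "d \<in> e"
  shows "c = d"
proof (rule ccontr)
  assume "c \<noteq> d"
  obtain w where w: "w \<in> e" "graph_leaf G w"
    using assms(2,4,5) unfolding p3_centers_def by blast
  have "graph_degree G c = 2" "graph_degree G d = 2"
    using assms(2,3) by (simp_all add: p3_centers_def)
  then have "w \<noteq> c" "w \<noteq> d" using w(2) by (auto simp: graph_leaf_def)
  have "card e = 2" using G assms(4) by (simp add: simple_graph_def)
  then have "finite e" by (metis card.infinite zero_neq_numeral)
  then have "card {w, c, d} \<le> card e" using assms w by (intro card_mono) auto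
  then show False using \<open>card e = 2\<close> \<open>c \<noteq> d\<close> \<open>w \<noteq> c\<close> \<open>w \<noteq> d\<close> by simp
qed

text \<open>
  The centres are split by whether their vertex sum is at most the number \<open>M\<close> of edges. A low sum
  is itself a label, which can only sit on an internal edge. High sums are expensive: \<open>u\<close> of them
  need at least \<open>u M + u (u + 1) / 2\<close> in total, whereas \<open>2 u\<close> labels supply at most
  \<open>2 u M - u (2 u - 1)\<close>.
\<close>

lemma antimagic_p3_bound:
  assumes G: "simple_graph G" and f: "antimagic_labeling G f"
  shows "5 * card (p3_centers G) \<le> 2 * card (edges G) + 5 * card (internal_edges G) + 1"
proof -
  define M where "M = card (edges G)"
  define L where "L = {c \<in> p3_centers G. vertex_sum G f c \<le> M}"
  define U where "U = {c \<in> p3_centers G. M < vertex_sum G f c}"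
  let ?inc = "\<lambda>c. {e \<in> edges G. c \<in> e}"
  define D where "D = (\<Union>c\<in>U. ?inc c)"
  have finE: "finite (edges G)" by (rule finite_edges[OF G])
  have finP: "finite (p3_centers G)" using G by (simp add: simple_graph_def p3_centers_def)
  have fin: "finite L" "finite U" using finP by (auto simp: L_def U_def)
  have sub: "L \<subseteq> verts G" "U \<subseteq> verts G" by (auto simp: L_def U_def p3_centers_def)
  have f_bij: "f ` edges G = {1..M}" "inj_on f (edges G)"
    using f by (auto simp: antimagic_labeling_def bij_betw_def M_def)
  \<comment> \<open>The edge whose label equals the sum of a low centre cannot end in a leaf \<open>w\<close>: it would be the
    only edge at \<open>w\<close>, so \<open>w\<close> and the centre would have equal sums.\<close>
  have "vertex_sum G f ` L \<subseteq> f ` internal_edges G"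
  proof
    fix s assume "s \<in> vertex_sum G f ` L"
    then obtain c where c: "c \<in> L" "s = vertex_sum G f c" by auto
    have c2: "c \<in> verts G" "graph_degree G c = 2" using c by (auto simp: L_def p3_centers_def)
    then have "0 < s" using c vertex_sum_pos[OF G f, of c] by simp
    then have "s \<in> f ` edges G" using c f_bij by (auto simp: L_def)
    then obtain e where e: "e \<in> edges G" "s = f e" by auto
    have "\<not> graph_leaf G w" if "w \<in> e" for w
    proof
      assume w: "graph_leaf G w"
      then have "card (?inc w) = 1" by (simp add: graph_leaf_def graph_degree_def)
      then obtain d where "?inc w = {d}" by (rule card_1_singletonE)
      moreover have "e \<in> ?inc w" using that e by simp
      ultimately have "?inc w = {e}" by simp
      then have "vertex_sum G f w = vertex_sum G f c" using e c by (simp add: vertex_sum_def)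
      then have "w = c"
        using inj_on_vertex_sum[OF f] w c2 by (auto simp: graph_leaf_def dest: inj_onD)
      then show False using w c2 by (simp add: graph_leaf_def)
    qed
    then show "s \<in> f ` internal_edges G" using e by (auto simp: internal_edges_def)
  qed
  then have "card (vertex_sum G f ` L) \<le> card (internal_edges G)"
    using finE by (intro surj_card_le) (auto simp: internal_edges_def)
  then have L: "card L \<le> card (internal_edges G)"
    using card_image[OF inj_on_subset[OF inj_on_vertex_sum[OF f] sub(1)]] by simp
  have disj: "\<forall>c\<in>U. \<forall>d\<in>U. c \<noteq> d \<longrightarrow> ?inc c \<inter> ?inc d = {}"
    using p3_centers_no_common_edge[OF G] unfolding U_def by blast
  have D: "D \<subseteq> edges G" by (auto simp: D_def)
  have "card D = (\<Sum>c\<in>U. card (?inc c))"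
    unfolding D_def using disj fin finE by (intro card_UN_disjoint) auto
  also have "\<dots> = (\<Sum>c\<in>U. 2)"
    by (rule sum.cong) (auto simp: U_def p3_centers_def graph_degree_def)
  finally have cD: "card D = 2 * card U" by simp
  have "\<Sum>(vertex_sum G f ` U) = (\<Sum>c\<in>U. vertex_sum G f c)"
    using sum.reindex[OF inj_on_subset[OF inj_on_vertex_sum[OF f] sub(2)], of "\<lambda>x. x"] by simp
  also have "\<dots> = (\<Sum>e\<in>D. f e)"
    unfolding D_def vertex_sum_def using disj fin finE
    by (subst sum.UNION_disjoint) auto
  also have "\<dots> = \<Sum>(f ` D)"
    using sum.reindex[OF inj_on_subset[OF f_bij(2) D], of "\<lambda>x. x"] by simp
  finally have eq: "\<Sum>(vertex_sum G f ` U) = \<Sum>(f ` D)" .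
  have cU: "card (vertex_sum G f ` U) = card U"
    using card_image[OF inj_on_subset[OF inj_on_vertex_sum[OF f] sub(2)]] .
  have "card (vertex_sum G f ` U) * (2 * M + card (vertex_sum G f ` U) + 1)
      \<le> 2 * \<Sum>(vertex_sum G f ` U)"
    using fin(2) by (intro sum_distinct_above) (auto simp: U_def)
  then have low: "card U * (2 * M + card U + 1) \<le> 2 * \<Sum>(f ` D)"
    unfolding cU eq .
  have "card (f ` D) = 2 * card U"
    using card_image[OF inj_on_subset[OF f_bij(2) D]] cD by simp
  moreover have "\<forall>x\<in>f ` D. x \<le> M"
    using image_mono[OF D, of f] unfolding f_bij(1) by auto
  ultimately have up: "2 * \<Sum>(f ` D) + (2 * card U) * (2 * card U) \<le> (2 * card U) * (2 * M + 1)"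
    using sum_distinct_below[of "f ` D" M] finite_subset[OF D finE] by simp
  \<comment> \<open>Both estimates have the factor \<open>card U\<close>; cancelling it leaves a linear inequality.\<close>
  have "card U * (2 * M + card U + 1 + 4 * card U) \<le> card U * (2 * (2 * M + 1))"
    using low up by (simp add: algebra_simps)
  then have "card U = 0 \<or> 2 * M + card U + 1 + 4 * card U \<le> 2 * (2 * M + 1)"
    by (simp only: mult_le_cancel1) linarith
  then have U: "5 * card U \<le> 2 * M + 1" by (elim disjE) simp_all
  have "p3_centers G = L \<union> U" by (auto simp: L_def U_def)
  then have "card (p3_centers G) \<le> card L + card U" by (simp add: card_Un_le)
  then show ?thesis using L U by (simp add: M_def)
qed

section \<open>Maps that identify a graph with a union of components\<close>

text \<open>
  Degrees, leaves and centres of \<open>P\<^sub>3\<close> components depend only on the edges at a vertex and at its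
  neighbours. A vertex map that is injective and carries the set of edges at each vertex exactly onto
  the set of edges at its image preserves all of them. Summands of a disjoint union,
  isomorphisms and inclusions of components are all of this kind, so each notion has to be transferred
  only once.
\<close>

definition star_preserving :: "('a \<Rightarrow> 'b) \<Rightarrow> 'a sgraph \<Rightarrow> 'b sgraph \<Rightarrow> bool" where
  "star_preserving h G H \<longleftrightarrow> inj_on h (verts G) \<and> h ` verts G \<subseteq> verts H \<and>
     (\<forall>v\<in>verts G. {e \<in> edges H. h v \<in> e} = (`) h ` {e \<in> edges G. v \<in> e})"

context
  fixes h :: "'a \<Rightarrow> 'b" and G H
  assumes h: "star_preserving h G H" and G: "simple_graph G"
begin

lemma star_preserving_degree:
  assumes "v \<in> verts G"
  shows "graph_degree H (h v) = graph_degree G v"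
proof -
  have "inj_on ((`) h) {e \<in> edges G. v \<in> e}"
  proof (rule inj_on_subset)
    show "inj_on ((`) h) (Pow (verts G))"
      using h by (intro inj_on_image_Pow) (simp add: star_preserving_def)
    show "{e \<in> edges G. v \<in> e} \<subseteq> Pow (verts G)"
      using G by (auto simp: simple_graph_def)
  qed
  then show ?thesis
    using h assms by (simp add: graph_degree_def star_preserving_def card_image)
qed

lemma star_preserving_leaf: "v \<in> verts G \<Longrightarrow> graph_leaf H (h v) \<longleftrightarrow> graph_leaf G v"
  using h star_preserving_degree unfolding graph_leaf_def star_preserving_def by auto

lemma star_preserving_p3_centers:
  assumes v: "v \<in> verts G"
  shows "h v \<in> p3_centers H \<longleftrightarrow> v \<in> p3_centers G"
proof -
  have leaf: "(\<exists>w\<in>h ` e. graph_leaf H w) \<longleftrightarrow> (\<exists>w\<in>e. graph_leaf G w)" if "e \<in> edges G" for e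
  proof -
    have "e \<subseteq> verts G" using that G by (auto simp: simple_graph_def)
    then show ?thesis using star_preserving_leaf by blast
  qed
  have "(\<forall>e\<in>edges H. h v \<in> e \<longrightarrow> (\<exists>w\<in>e. graph_leaf H w))
     \<longleftrightarrow> (\<forall>e\<in>{e \<in> edges H. h v \<in> e}. \<exists>w\<in>e. graph_leaf H w)" by blast
  also have "\<dots> \<longleftrightarrow> (\<forall>e\<in>{e \<in> edges G. v \<in> e}. \<exists>w\<in>h ` e. graph_leaf H w)"
    using h v by (simp add: star_preserving_def)
  also have "\<dots> \<longleftrightarrow> (\<forall>e\<in>edges G. v \<in> e \<longrightarrow> (\<exists>w\<in>e. graph_leaf G w))"
    using leaf by blast
  finally show ?thesis
    using h v star_preserving_degree[OF v] by (auto simp: p3_centers_def star_preserving_def)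
qed

end

text \<open>
  The edges \<open>R\<close> are those of the other components of \<open>H\<close>.
\<close>

lemma star_preservingI:
  assumes G: "simple_graph G" and inj: "inj_on h (verts G)" and "h ` verts G \<subseteq> verts H"
    and E: "edges H = (`) h ` edges G \<union> R" and R: "\<And>e v. e \<in> R \<Longrightarrow> v \<in> verts G \<Longrightarrow> h v \<notin> e"
  shows "star_preserving h G H"
proof -
  have "{e \<in> edges H. h v \<in> e} = (`) h ` {e \<in> edges G. v \<in> e}" if v: "v \<in> verts G" for v
  proof -
    have "h v \<in> h ` e \<longleftrightarrow> v \<in> e" if "e \<in> edges G" for e
      using that G inj_on_image_mem_iff[OF inj v] by (simp add: simple_graph_def)
    then show ?thesis unfolding E using R v by blast
  qed
  then show ?thesis using assms by (simp add: star_preserving_def)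
qed

lemma star_preserving_Inl:
  "simple_graph G \<Longrightarrow> star_preserving Inl G (disjoint_union G H)"
  by (rule star_preservingI[where R = "(`) Inr ` edges H"]) (auto simp: disjoint_union_def)

lemma star_preserving_copy:
  assumes "simple_graph H" "i < t"
  shows "star_preserving (\<lambda>x. Inr (i, x)) H (disjoint_union G (graph_copies t H))"
proof (rule star_preservingI[OF assms(1)])
  let ?R = "(`) Inl ` edges G \<union> (\<Union>j\<in>{..<t} - {i}. (`) (\<lambda>x. Inr (j, x)) ` edges H)"
  have t: "{..<t} = insert i ({..<t} - {i})" using assms(2) by blast
  have "edges (disjoint_union G (graph_copies t H))
      = (`) Inl ` edges G \<union> (\<Union>j<t. (`) (\<lambda>x. Inr (j, x)) ` edges H)"
    by (simp add: disjoint_union_def graph_copies_def image_UN image_image)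
  also have "\<dots> = (`) (\<lambda>x. Inr (i, x)) ` edges H \<union> ?R"
    by (subst t) blast
  finally show "edges (disjoint_union G (graph_copies t H))
      = (`) (\<lambda>x. Inr (i, x)) ` edges H \<union> ?R" .
  show "Inr (i, v) \<notin> e" if "e \<in> ?R" for e v
    using that by auto
qed (use assms in \<open>auto simp: disjoint_union_def graph_copies_def inj_on_def\<close>)

lemma star_preserving_iso:
  assumes "simple_graph C" "bij_betw h (verts C) (verts H)" "(`) h ` edges C = edges H"
  shows "star_preserving h C H"
  by (rule star_preservingI[where R = "{}"]) (use assms in \<open>auto simp: bij_betw_def\<close>)

section \<open>The three-vertex path\<close>

lemma path_graph_3: "path_graph 3 = SGraph {0, 1, 2} {{0, 1}, {1, 2}}"
proof -
  have "{{i, Suc i} | i. Suc i < 3} = {{0, 1}, {1, 2}}"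
    by (auto simp: less_Suc_eq numeral_eq_Suc)
  moreover have "{..<3} = {0, 1, 2 :: nat}" by auto
  ultimately show ?thesis by (simp add: path_graph_def)
qed

lemma simple_path_graph_3: "simple_graph (path_graph 3)"
  by (simp add: simple_graph_def path_graph_3)

lemma stars_path_graph_3:
  "{e \<in> edges (path_graph 3). 0 \<in> e} = {{0, 1}}"
  "{e \<in> edges (path_graph 3). 1 \<in> e} = {{0, 1}, {1, 2}}"
  "{e \<in> edges (path_graph 3). 2 \<in> e} = {{1, 2}}"
  by (auto simp: path_graph_3)

lemma degree_path_graph_3:
  "graph_degree (path_graph 3) 0 = 1" "graph_degree (path_graph 3) 1 = 2"
  "graph_degree (path_graph 3) 2 = 1"
  unfolding graph_degree_def stars_path_graph_3 by (simp_all add: doubleton_eq_iff)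

lemma leaves_path_graph_3:
  "graph_leaf (path_graph 3) 0" "graph_leaf (path_graph 3) 2"
  using degree_path_graph_3 by (auto simp: graph_leaf_def path_graph_3)

lemma center_path_graph_3: "1 \<in> p3_centers (path_graph 3)"
  using degree_path_graph_3 leaves_path_graph_3
  by (auto simp: p3_centers_def path_graph_3)

lemma edge_path_graph_3_has_leaf:
  "e \<in> edges (path_graph 3) \<Longrightarrow> \<exists>v\<in>e. graph_leaf (path_graph 3) v"
  using leaves_path_graph_3 by (auto simp: path_graph_3)

section \<open>Connected components\<close>

lemma equiv_connected_rel: "equiv (verts G) (connected_rel G)"
proof (rule equivI)
  show "connected_rel G \<subseteq> verts G \<times> verts G" "refl_on (verts G) (connected_rel G)"
    by (auto simp: connected_rel_def refl_on_def)
  have "sym ({(u, v). {u, v} \<in> edges G}\<^sup>*)"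
    by (intro sym_rtrancl symI) (simp add: insert_commute)
  then show "sym (connected_rel G)"
    by (auto simp: connected_rel_def sym_def)
  show "trans (connected_rel G)"
    by (rule transI) (auto simp: connected_rel_def intro: rtrancl_trans)
qed

text \<open>
  An edge with one end in a component lies entirely in it, so passing to the component loses no edge
  at any of its vertices.
\<close>

lemma star_preserving_component:
  assumes G: "simple_graph G"
  shows "star_preserving id (induced_subgraph G (connected_rel G `` {v})) G"
proof -
  let ?S = "connected_rel G `` {v}"
  have "e \<subseteq> ?S" if e: "e \<in> edges G" and u: "u \<in> e" "u \<in> ?S" for e u
  proof
    fix w assume w: "w \<in> e"
    have ver: "u \<in> verts G" "w \<in> verts G" using e u w G by (auto simp: simple_graph_def)
    have "(u, w) \<in> connected_rel G"
    proof (cases "u = w")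
      case True
      then show ?thesis using ver by (simp add: connected_rel_def)
    next
      case False
      have "card e = 2" using e G by (simp add: simple_graph_def)
      then have "e = {u, w}" using False u w by (auto simp: card_2_iff)
      then show ?thesis using ver e by (auto simp: connected_rel_def)
    qed
    then show "w \<in> ?S" using u equiv_connected_rel[of G] by (auto elim: equivE dest: transD)
  qed
  then show ?thesis
    unfolding star_preserving_def induced_subgraph_def by auto
qed

lemma simple_induced_subgraph: "simple_graph G \<Longrightarrow> simple_graph (induced_subgraph G S)"
  by (auto simp: simple_graph_def induced_subgraph_def)

text \<open>
  Every \<open>P\<^sub>3\<close> component is the component of its own centre, so sending each vertex to its component
  maps the centres onto these components.
\<close>

lemma card_p3_components_le:
  assumes G: "simple_graph G"
  shows "card {C \<in> graph_components G. graph_iso C (path_graph 3)} \<le> card (p3_centers G)"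
proof (rule surj_card_le)
  show "finite (p3_centers G)" using G by (simp add: simple_graph_def p3_centers_def)
  let ?comp = "\<lambda>v. induced_subgraph G (connected_rel G `` {v})"
  show "{C \<in> graph_components G. graph_iso C (path_graph 3)} \<subseteq> ?comp ` p3_centers G"
  proof
    fix C assume "C \<in> {C \<in> graph_components G. graph_iso C (path_graph 3)}"
    then obtain v h where v: "C = ?comp v"
      and h: "bij_betw h (verts C) (verts (path_graph 3))"
        "(`) h ` edges C = edges (path_graph 3)"
      by (auto simp: graph_components_def quotient_def graph_iso_def)
    have C: "simple_graph C" using v simple_induced_subgraph[OF G] by simp
    have "1 \<in> h ` verts C" using h(1) by (simp add: bij_betw_def path_graph_3)
    then obtain c where c: "c \<in> verts C" "h c = 1" by (metis imageE)
    have "c \<in> p3_centers C"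
      using star_preserving_p3_centers[OF star_preserving_iso[OF C h] C c(1)] c(2)
        center_path_graph_3 by simp
    then have cent: "c \<in> p3_centers G"
      using star_preserving_p3_centers[OF star_preserving_component[OF G], of v c] C c(1)
      unfolding v by simp
    have "(v, c) \<in> connected_rel G" using c v by (auto simp: induced_subgraph_def)
    then have "?comp v = ?comp c" using equiv_class_eq[OF equiv_connected_rel] by metis
    then show "C \<in> ?comp ` p3_centers G" using v cent by blast
  qed
qed

text \<open>
  The component of an isolated vertex consists of this vertex only and so contains no edge.
\<close>

lemma component_edge_imp_degree:
  assumes G: "simple_graph G" and comp: "\<forall>C\<in>graph_components G. edges C \<noteq> {}"
    and v: "v \<in> verts G"
  shows "graph_degree G v \<noteq> 0"
proof
  assume "graph_degree G v = 0"
  then have no: "e \<notin> edges G" if "v \<in> e" for e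
    using that finite_edges[OF G] by (auto simp: graph_degree_def)
  let ?S = "connected_rel G `` {v}"
  have "w = v" if "(v, w) \<in> {(u, w). {u, w} \<in> edges G}\<^sup>*" for w
    using that no by (induction rule: rtrancl_induct) auto
  then have S: "?S \<subseteq> {v}" by (auto simp: connected_rel_def)
  have "induced_subgraph G ?S \<in> graph_components G"
    using v by (auto simp: graph_components_def intro: quotientI)
  then obtain e where "e \<in> edges G" "e \<subseteq> ?S"
    using comp by (fastforce simp: induced_subgraph_def)
  moreover from this have "e \<noteq> {}" using G by (auto simp: simple_graph_def)
  ultimately show False using S no by blast
qed

section \<open>Counting the vertices of a forest\<close>

text \<open>
  A path without repeated vertices from \<open>u\<close> to \<open>v\<close> is closed by the edge \<open>{u, v}\<close>. It has at least
  three vertices because \<open>u\<close> and \<open>v\<close> are distinct and not adjacent in \<open>E\<close>.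
\<close>

lemma connected_without_edge_imp_cycle:
  assumes "u \<noteq> v" "{u, v} \<notin> E" "(u, v) \<in> {(x, y). {x, y} \<in> E}\<^sup>*"
  shows "\<exists>vs. graph_cycle (SGraph V (insert {u, v} E)) vs"
proof -
  let ?r = "\<lambda>x y. {x, y} \<in> E"
  have "?r\<^sup>*\<^sup>* u v" using assms(3) by (simp add: rtranclp_rtrancl_eq)
  then obtain xs0 where "rtrancl_path ?r u xs0 v" by (auto simp: rtranclp_eq_rtrancl_path)
  then obtain xs where xs: "rtrancl_path ?r u xs v" "distinct (u # xs)"
    by (rule rtrancl_path_distinct)
  have ne: "xs \<noteq> []" using xs assms(1) by (auto elim: rtrancl_path.cases)
  have last: "last xs = v" using rtrancl_path_last[OF xs(1) ne] .
  have step: "{(u # xs) ! i, xs ! i} \<in> E" if "i < length xs" for i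
    using rtrancl_path_nth[OF xs(1) that] .
  have "length xs \<noteq> 1"
  proof
    assume l: "length xs = 1"
    then have "xs ! 0 = v" using last ne by (simp add: last_conv_nth)
    then show False using step[of 0] l assms(2) by simp
  qed
  then have len: "3 \<le> length (u # xs)" using ne by (cases xs) (auto simp: Suc_le_eq)
  have "{(u # xs) ! i, (u # xs) ! (Suc i mod length (u # xs))} \<in> insert {u, v} E"
    if i: "i < length (u # xs)" for i
  proof (cases "i = length xs")
    case True
    then have "(u # xs) ! i = v" using last ne by (simp add: last_conv_nth nth_Cons')
    then show ?thesis using True by (simp add: insert_commute)
  next
    case False
    then show ?thesis using i step[of i] by simp
  qed
  then show ?thesis using xs(2) len unfolding graph_cycle_def by (intro exI[of _ "u # xs"]) simp
qed

text \<open>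
  The edges are added one at a time, starting from the isolated vertices. As no cycle arises, each new
  edge joins two vertices that were not yet connected, so it merges two classes into one and the
  number of classes drops.
\<close>

lemma forest_card_edges_plus_classes:
  assumes "finite E" "finite V" "\<forall>e\<in>E. e \<subseteq> V \<and> card e = 2" "\<nexists>vs. graph_cycle (SGraph V E) vs"
  shows "card E + card (V // connected_rel (SGraph V E)) \<le> card V"
  using assms
proof (induction E rule: finite_induct)
  case empty
  have "connected_rel (SGraph V {}) = Id_on V" by (auto simp: connected_rel_def)
  then have "V // connected_rel (SGraph V {}) = (\<lambda>v. {v}) ` V" by (auto simp: quotient_def)
  then show ?case using empty card_image_le[of V "\<lambda>v. {v}"] by simp
next
  case (insert e E)
  let ?r = "connected_rel (SGraph V E)" and ?s = "connected_rel (SGraph V (insert e E))"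
  have "card e = 2" "e \<subseteq> V" using insert by auto
  then obtain u v where e: "e = {u, v}" "u \<noteq> v" "u \<in> V" "v \<in> V"
    by (auto simp: card_2_iff)
  have "\<nexists>vs. graph_cycle (SGraph V E) vs" using insert.prems(3) by (fastforce simp: graph_cycle_def)
  then have IH: "card E + card (V // ?r) \<le> card V" using insert by auto
  have not_r: "(u, v) \<notin> ?r"
    using connected_without_edge_imp_cycle[of u v E V] insert e
    by (auto simp: connected_rel_def)
  have in_s: "(u, v) \<in> ?s" using e by (auto simp: connected_rel_def)
  have er: "equiv V ?r" and es: "equiv V ?s"
    using equiv_connected_rel[of "SGraph V E"] equiv_connected_rel[of "SGraph V (insert e E)"] by auto
  have "{(x, y). {x, y} \<in> E}\<^sup>* \<subseteq> {(x, y). {x, y} \<in> insert e E}\<^sup>*"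
    by (rule rtrancl_mono) auto
  then have rs: "?r \<subseteq> ?s" by (auto simp: connected_rel_def)
  have merge: "?s `` (?r `` {x}) = ?s `` {x}" if "x \<in> V" for x
  proof -
    have "(x, x) \<in> ?r" using that by (simp add: connected_rel_def)
    then show ?thesis using rs es by (blast elim: equivE dest: transD)
  qed
  let ?A = "V // ?r"
  have finA: "finite ?A"
    using insert.prems(1) er by (simp add: finite_quotient equiv_type)
  have uA: "?r `` {u} \<in> ?A" "?r `` {v} \<in> ?A" using e by (auto intro: quotientI)
  have ne: "?r `` {u} \<noteq> ?r `` {v}"
    using not_r eq_equiv_class[OF _ er e(4)] by blast
  have "?s `` (?r `` {u}) = ?s `` (?r `` {v})"
    using merge e equiv_class_eq[OF es in_s] by simp
  \<comment> \<open>Each new class is obtained from an old one, and the old class of \<open>u\<close> can be omitted since that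
    of \<open>v\<close> yields the same new class.\<close>
  have "V // ?s \<subseteq> (\<lambda>X. ?s `` X) ` (?A - {?r `` {u}})"
  proof
    fix Y assume "Y \<in> V // ?s"
    then obtain x where x: "x \<in> V" "Y = ?s `` {x}" by (auto elim: quotientE)
    have xY: "Y = ?s `` (?r `` {x})" using x merge by simp
    show "Y \<in> (\<lambda>X. ?s `` X) ` (?A - {?r `` {u}})"
    proof (cases "?r `` {x} = ?r `` {u}")
      case True
      then have "Y = ?s `` (?r `` {v})"
        using xY \<open>?s `` (?r `` {u}) = ?s `` (?r `` {v})\<close> by simp
      then show ?thesis using uA ne by blast
    next
      case False
      have "?r `` {x} \<in> ?A" using x by (auto intro: quotientI)
      then show ?thesis using False xY by blast
    qed
  qed
  then have "card (V // ?s) \<le> card (?A - {?r `` {u}})"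
    using finA by (intro surj_card_le) auto
  also have "\<dots> = card ?A - 1" using finA uA by simp
  finally have "card (V // ?s) \<le> card ?A - 1" .
  moreover have "0 < card ?A" using finA uA by (auto simp: card_gt_0_iff)
  ultimately show ?case using IH insert by simp
qed

lemma forest_card_edges_plus_components:
  assumes "forest F"
  shows "card (edges F) + card (graph_components F) \<le> card (verts F)"
proof -
  have F: "simple_graph F" "\<nexists>vs. graph_cycle F vs" using assms by (auto simp: forest_def)
  have "card (edges F) + card (verts F // connected_rel F) \<le> card (verts F)"
    using forest_card_edges_plus_classes[of "edges F" "verts F"] F finite_edges[OF F(1)]
    by (simp add: simple_graph_def)
  moreover have "finite (verts F // connected_rel F)"
    using F(1) equiv_connected_rel[of F] by (simp add: simple_graph_def finite_quotient equiv_type)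
  then have "card (graph_components F) \<le> card (verts F // connected_rel F)"
    unfolding graph_components_def by (rule card_image_le)
  ultimately show ?thesis by simp
qed

section \<open>Adding copies of the three-vertex path\<close>

abbreviation add_paths :: "nat \<Rightarrow> 'a sgraph \<Rightarrow> ('a + nat \<times> nat) sgraph" where
  "add_paths t G \<equiv> disjoint_union G (graph_copies t (path_graph 3))"

lemma verts_add_paths: "verts (add_paths t G) = Inl ` verts G \<union> (\<Union>i<t. (\<lambda>x. Inr (i, x)) ` verts (path_graph 3))"
  by (auto simp: disjoint_union_def graph_copies_def)

lemma edges_add_paths:
  "edges (add_paths t G) = (`) Inl ` edges G \<union> (\<Union>i<t. (`) (\<lambda>x. Inr (i, x)) ` edges (path_graph 3))"
  by (auto simp: disjoint_union_def graph_copies_def image_UN image_image)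

lemma simple_add_paths:
  assumes "simple_graph G"
  shows "simple_graph (add_paths t G)"
  unfolding simple_graph_def
proof (intro conjI ballI)
  show "finite (verts (add_paths t G))"
    using assms simple_path_graph_3 unfolding verts_add_paths by (auto simp: simple_graph_def)
  fix e assume "e \<in> edges (add_paths t G)"
  then show "e \<subseteq> verts (add_paths t G)" "card e = 2"
    using assms simple_path_graph_3 unfolding verts_add_paths edges_add_paths
    by (fastforce simp: simple_graph_def card_image inj_on_def)+
qed

lemma card_verts_add_paths:
  "simple_graph G \<Longrightarrow> card (verts (add_paths t G)) = card (verts G) + 3 * t"
  by (simp add: disjoint_union_def graph_copies_def path_graph_3 card_Plus simple_graph_def
      card_cartesian_product)

lemma card_edges_add_paths_le:
  assumes "simple_graph G"
  shows "card (edges (add_paths t G)) \<le> card (edges G) + 2 * t"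
proof -
  have c2: "card (edges (path_graph 3)) \<le> 2"
    by (simp add: path_graph_3 card_insert_if)
  have "card (\<Union>i<t. (`) (\<lambda>x. Inr (i, x) :: 'a + nat \<times> nat) ` edges (path_graph 3))
      \<le> (\<Sum>i<t. card ((`) (\<lambda>x. Inr (i, x) :: 'a + nat \<times> nat) ` edges (path_graph 3)))"
    by (rule card_UN_le) simp
  also have "\<dots> \<le> (\<Sum>i<t. 2)"
    by (intro sum_mono order_trans[OF card_image_le c2])
      (rule finite_edges[OF simple_path_graph_3])
  finally have "card (\<Union>i<t. (`) (\<lambda>x. Inr (i, x) :: 'a + nat \<times> nat) ` edges (path_graph 3)) \<le> 2 * t"
    by simp
  moreover have "card ((`) (Inl :: 'a \<Rightarrow> 'a + nat \<times> nat) ` edges G) \<le> card (edges G)"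
    by (rule card_image_le[OF finite_edges[OF assms]])
  ultimately show ?thesis
    unfolding edges_add_paths by (meson add_mono card_Un_le order_trans)
qed

lemma degree_add_paths:
  assumes G: "simple_graph G" "\<forall>v\<in>verts G. graph_degree G v \<noteq> 0"
    and v: "v \<in> verts (add_paths t G)"
  shows "graph_degree (add_paths t G) v \<noteq> 0"
proof -
  consider u where "u \<in> verts G" "v = Inl u"
    | i x where "i < t" "x \<in> verts (path_graph 3)" "v = Inr (i, x)"
    using v unfolding verts_add_paths by auto
  then show ?thesis
  proof cases
    case 1
    then show ?thesis using star_preserving_degree[OF star_preserving_Inl[OF G(1), of "graph_copies t (path_graph 3)"] G(1)] G(2) by simp
  next
    case 2
    have "graph_degree (path_graph 3) x \<noteq> 0"
      using 2(2) degree_path_graph_3 by (auto simp: path_graph_3)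
    then show ?thesis
      using star_preserving_degree[OF star_preserving_copy[OF simple_path_graph_3 2(1), where G = G]
          simple_path_graph_3 2(2)] 2(3)
      by simp
  qed
qed

text \<open>
  The added paths have no internal edges, and an edge of \<open>G\<close> keeps its leaves.
\<close>

lemma card_internal_edges_add_paths_le:
  assumes G: "simple_graph G"
  shows "card (internal_edges (add_paths t G)) \<le> card (internal_edges G)"
proof (rule surj_card_le)
  show "finite (internal_edges G)" using finite_edges[OF G] by (simp add: internal_edges_def)
  show "internal_edges (add_paths t G) \<subseteq> (`) Inl ` internal_edges G"
  proof
    fix e assume e: "e \<in> internal_edges (add_paths t G)"
    then have noleaf: "\<not> graph_leaf (add_paths t G) v" if "v \<in> e" for v
      using that by (simp add: internal_edges_def)
    have "e \<in> edges (add_paths t G)" using e by (simp add: internal_edges_def)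
    then consider d where "d \<in> edges G" "e = Inl ` d"
      | i d where "i < t" "d \<in> edges (path_graph 3)" "e = (\<lambda>x. Inr (i, x)) ` d"
      unfolding edges_add_paths by auto
    then show "e \<in> (`) Inl ` internal_edges G"
    proof cases
      case 1
      have "d \<subseteq> verts G" using 1(1) G by (simp add: simple_graph_def)
      then have "\<not> graph_leaf G w" if "w \<in> d" for w
        using that noleaf[of "Inl w"] 1(2) star_preserving_leaf[OF star_preserving_Inl[OF G, of "graph_copies t (path_graph 3)"] G] by blast
      then show ?thesis using 1 by (auto simp: internal_edges_def)
    next
      case 2
      then obtain w where w: "w \<in> d" "graph_leaf (path_graph 3) w"
        using edge_path_graph_3_has_leaf by blast
      then have "graph_leaf (add_paths t G) (Inr (i, w))"
        using star_preserving_leaf[OF star_preserving_copy[OF simple_path_graph_3 2(1)] simple_path_graph_3]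
        by (auto simp: graph_leaf_def)
      then show ?thesis using noleaf 2(3) w(1) by blast
    qed
  qed
qed

lemma card_p3_centers_add_paths_ge:
  assumes G: "simple_graph G"
  shows "card (p3_centers G) + t \<le> card (p3_centers (add_paths t G))"
proof -
  let ?A = "Inl ` p3_centers G :: ('a + nat \<times> nat) set"
    and ?B = "(\<lambda>i. Inr (i, 1)) ` {..<t} :: ('a + nat \<times> nat) set"
  have finP: "finite (p3_centers G)" using G by (simp add: simple_graph_def p3_centers_def)
  have "Inl v \<in> p3_centers (add_paths t G)" if v: "v \<in> p3_centers G" for v
  proof -
    have "v \<in> verts G" using v by (simp add: p3_centers_def)
    then show ?thesis using star_preserving_p3_centers[OF star_preserving_Inl[OF G] G] v by blast
  qed
  moreover have "Inr (i, 1) \<in> p3_centers (add_paths t G)" if "i < t" for i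
  proof -
    have "1 \<in> verts (path_graph 3)" by (simp add: path_graph_3)
    then show ?thesis
      using star_preserving_p3_centers[OF star_preserving_copy[OF simple_path_graph_3 that]
          simple_path_graph_3] center_path_graph_3 by blast
  qed
  moreover have "finite (p3_centers (add_paths t G))"
    using simple_add_paths[OF G, of t] by (simp add: simple_graph_def p3_centers_def)
  ultimately have "card (?A \<union> ?B) \<le> card (p3_centers (add_paths t G))"
    by (blast intro: card_mono)
  moreover have "card (?A \<union> ?B) = card ?A + card ?B"
    using finP by (intro card_Un_disjoint) auto
  moreover have "card ?A = card (p3_centers G)" "card ?B = t"
    by (simp_all add: card_image inj_on_def)
  ultimately show ?thesis by simp
qed

section \<open>The two bounds\<close>

text \<open>
  Completing the squares turns the hypotheses into \<open>(x + 1/2)\<^sup>2 \<le> 2 (y + 1/2)\<^sup>2\<close> with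
  \<open>x = m + q + 3 t\<close> and \<open>y = m + 2 t\<close>. After taking roots, \<open>t\<close> has the coefficient \<open>3 - 2 sqrt 2\<close>, whose
  inverse is \<open>3 + 2 sqrt 2\<close>.
\<close>

lemma quadratic_bound:
  fixes n M m q t :: nat
  assumes "n * (n + 1) \<le> 2 * (M * (M + 1))" "m + q + 3 * t \<le> n" "M \<le> m + 2 * t"
  shows "real t \<le> - real q * (3 + 2 * sqrt 2) + (1 + sqrt 2) * (real m + 1 / 2)"
proof -
  define x y where "x = real m + real q + 3 * real t" and "y = real m + 2 * real t"
  have "(m + q + 3 * t) * (m + q + 3 * t + 1) \<le> n * (n + 1)"
    using assms(2) by (intro mult_mono) auto
  also have "\<dots> \<le> 2 * (M * (M + 1))" by (rule assms(1))
  also have "\<dots> \<le> 2 * ((m + 2 * t) * (m + 2 * t + 1))"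
    using assms(3) by (intro mult_mono) auto
  finally have "real ((m + q + 3 * t) * (m + q + 3 * t + 1))
      \<le> real (2 * ((m + 2 * t) * (m + 2 * t + 1)))"
    by (simp only: of_nat_le_iff)
  then have "x * (x + 1) \<le> 2 * (y * (y + 1))"
    by (simp only: x_def y_def of_nat_mult of_nat_add of_nat_numeral of_nat_1)
  then have "(x + 1 / 2)\<^sup>2 \<le> 2 * (y + 1 / 2)\<^sup>2"
    by (simp add: power2_eq_square algebra_simps)
  then have "x + 1 / 2 \<le> sqrt (2 * (y + 1 / 2)\<^sup>2)" by (rule real_le_rsqrt)
  also have "\<dots> = sqrt 2 * (y + 1 / 2)" by (simp add: real_sqrt_mult y_def)
  finally have "0 \<le> (3 + 2 * sqrt 2) * (sqrt 2 * (y + 1 / 2) - (x + 1 / 2))" by simp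
  also have "\<dots> = - real q * (3 + 2 * sqrt 2) + (1 + sqrt 2) * (real m + 1 / 2) - real t"
    by (simp add: x_def y_def algebra_simps)
  finally show ?thesis by simp
qed

theorem corollary3:
  fixes F :: "'a sgraph" and m q t' k :: nat
  assumes "forest F"
    and "edges F \<noteq> {}"
    and "\<forall>C\<in>graph_components F. 2 \<le> card (edges C)"
    and "m = card (edges F)"
    and "q = card (graph_components F)"
    and "t' = card {C \<in> graph_components F. graph_iso C (path_graph 3)}"
    and "k = card (internal_edges F)"
  shows "tau F \<le> ereal (min
           (- real q * (3 + 2 * sqrt 2) + (1 + sqrt 2) * (real m + 1 / 2))
           (2 * real m + 5 * (real k - real t') + 1))"
proof -
  have F: "simple_graph F" using assms(1) by (simp add: forest_def)
  have "\<forall>C\<in>graph_components F. edges C \<noteq> {}" using assms(3) by fastforce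
  then have deg: "\<forall>v\<in>verts F. graph_degree F v \<noteq> 0"
    using component_edge_imp_degree[OF F] by blast
  have "real t \<le> - real q * (3 + 2 * sqrt 2) + (1 + sqrt 2) * (real m + 1 / 2) \<and>
      real t \<le> 2 * real m + 5 * (real k - real t') + 1" if am: "antimagic (add_paths t F)" for t
  proof
    obtain f where f: "antimagic_labeling (add_paths t F) f"
      using am by (auto simp: antimagic_def)
    note H = simple_add_paths[OF F, of t]
    have M: "card (edges (add_paths t F)) \<le> m + 2 * t"
      using card_edges_add_paths_le[OF F] assms(4) by simp
    have "m + q + 3 * t \<le> card (verts (add_paths t F))"
      using forest_card_edges_plus_components[OF assms(1)] card_verts_add_paths[OF F] assms(4,5)
      by simp
    then show "real t \<le> - real q * (3 + 2 * sqrt 2) + (1 + sqrt 2) * (real m + 1 / 2)"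
      using antimagic_vertex_bound[OF H f] degree_add_paths[OF F deg] M
      by (intro quadratic_bound) auto
    have "t' + t \<le> card (p3_centers (add_paths t F))"
      using card_p3_components_le[OF F] card_p3_centers_add_paths_ge[OF F, of t] assms(6) by simp
    moreover have "card (internal_edges (add_paths t F)) \<le> k"
      using card_internal_edges_add_paths_le[OF F] assms(7) by simp
    moreover note antimagic_p3_bound[OF H f] M
    moreover have "5 * a \<le> 2 * d + 5 * k + 1"
      if "a \<le> p" "i \<le> k" "5 * p \<le> 2 * e + 5 * i + 1" "e \<le> d" for a p i e d :: nat
      using that by linarith
    ultimately have "5 * (t' + t) \<le> 2 * (m + 2 * t) + 5 * k + 1" by blast
    then have "real (5 * (t' + t)) \<le> real (2 * (m + 2 * t) + 5 * k + 1)"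
      by (simp only: of_nat_le_iff)
    then show "real t \<le> 2 * real m + 5 * (real k - real t') + 1" by simp
  qed
  then show ?thesis
    unfolding tau_def by (auto intro!: Sup_least)
qed

end
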